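(* Suppose $F$ satisfies conditions (A0), (A1) and (A2) with constants $\kappa_1,\kappa_2$, and let $\varepsilon>0$. If $\lambda\ge8L\kappa_1/\varepsilon$ and $\gamma\ge8L\kappa_2/\varepsilon$, then the estimator $\widetilde\theta$ is $(\varepsilon,0)$ individual differentially private.
   Context: Data: there are $n$ items indexed by $[n]$ and $m$ users; each user $s\in[m]$ makes $L$ comparisons, where comparison $l\in[L]$ consists of an unordered pair $\{i,j\}\subset[n]$ and an outcome $Y^{(s,l)}_{ij}\in\{+1,-1\}$ ($i<j$; $+1$ if $i$ is preferred, $-1$ if $j$ is preferred). Regularity conditions on $F$ ($F$ is twice differentiable): (A0) $F:\mathbb R\to[0,1]$ is strictly increasing and $F(x)=1-F(-x)$ for all $x$. (A1) There is an absolute constant $\kappa_1>0$ with $\sup_{x}\frac{F'(x)}{F(x)(1-F(x))}<\kappa_1$. (A2) $\frac{\partial^2}{\partial x^2}(-\log F(x))>0$ for all $x$, and there is an absolute constant $\kappa_2>0$ with $\frac{\partial^2}{\partial x^2}(-\log F(x))<\kappa_2$ for all $x$ and $\min_{|x|\le 4}\frac{\partial^2}{\partial x^2}(-\log F(x))>1/\kappa_2$. Estimator. Let $M_{ij}$ be the number of pairs $(s,l)\in[m]\times[L]$ in which $\{i,j\}$ is compared, and $\bar Y_{ij}=\frac1{M_{ij}}\sum_{(s,l):\,\{i,j\}\text{ compared}}\frac{1+Y^{(s,l)}_{ij}}2$. With $F_{ij}(\theta)=F(\theta_i-\theta_j)$, $$\mathcal L(\theta;Y)=\sum_{1\le i<j\le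 n}M_{ij}\left[-\bar Y_{ij}\log F_{ij}(\theta)-(1-\bar Y_{ij})\log(1-F_{ij}(\theta))\right],$$ $$\widetilde\theta=\arg\min_{\theta\in\mathbb R^n}\ \mathcal L(\theta;Y)+\frac\gamma2\|\theta\|_2^2+w^\top\theta,$$ where $w$ has i.i.d. Laplace entries with scale $\lambda$ (density $\frac1{2\lambda}e^{-|x|/\lambda}$), independent of the data. Individual differential privacy. Two data sets are adjacent if one is obtained from the other by replacing all $L$ comparisons (pairs and outcomes) of one single user. A randomized algorithm $M$ is $(\varepsilon,\delta)$ individual differentially private if $\Pr(M(\mathcal D)\in A)\le e^\varepsilon\Pr(M(\mathcal D')\in A)+\delta$ for all adjacent $\mathcal D,\mathcal D'$ and all measurable $A$. *)

theory Defs
  imports "HOL-Probability.Probability"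
begin

text \<open>
  Items are the elements of a finite linearly ordered type \<open>'n\<close>, so that parameter vectors live in
  \<open>real ^ 'n\<close>; users and comparisons are numbered from 1.
\<close>

text \<open>
  A comparison is an unordered pair together with an outcome.  The outcome of \<open>{i, j}\<close> with
  \<open>i < j\<close> is 1 if \<open>i\<close> is preferred and -1 if \<open>j\<close> is preferred.
\<close>

type_synonym 'n comparison = "'n set \<times> real"

type_synonym 'n dataset = "nat \<Rightarrow> nat \<Rightarrow> 'n comparison"

definition comparisons :: "'n::linorder comparison set" where
  "comparisons = {({i, j}, y) | i j y. i < j \<and> y \<in> {1, -1}}"

definition datasets :: "nat \<Rightarrow> nat \<Rightarrow> 'n::linorder dataset set" where
  "datasets m L = ({1..m} \<rightarrow>\<^sub>E ({1..L} \<rightarrow>\<^sub>E comparisons))"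

definition adjacent :: "nat \<Rightarrow> nat \<Rightarrow> 'n::linorder dataset \<Rightarrow> 'n::linorder dataset \<Rightarrow> bool" where
  "adjacent m L D D' \<longleftrightarrow>
     D \<in> datasets m L \<and> (\<exists>s\<in>{1..m}. \<exists>c \<in> {1..L} \<rightarrow>\<^sub>E comparisons. D' = D(s := c))"

text \<open>
  A randomized algorithm with outputs in the measurable space \<open>N\<close> is represented by its output
  distributions.  Membership in \<open>space (prob_algebra N)\<close> says that \<open>M D\<close> is a probability
  distribution on \<open>N\<close>; for a push-forward \<open>distr P N f\<close> of a probability measure this forces \<open>f\<close> to
  be measurable, so the inequality below is never about sets of undefined probability.
\<close>

definition individual_dp ::
    "nat \<Rightarrow> nat \<Rightarrow> 'b measure \<Rightarrow> ('n::linorder dataset \<Rightarrow> 'b measure) \<Rightarrow> real \<Rightarrow> real \<Rightarrow> bool" where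
  "individual_dp m L N M \<epsilon> \<delta> \<longleftrightarrow>
     (\<forall>D \<in> datasets m L. M D \<in> space (prob_algebra N)) \<and>
     (\<forall>D D'. adjacent m L D D' \<longrightarrow>
        (\<forall>A \<in> sets N. measure (M D) A \<le> exp \<epsilon> * measure (M D') A + \<delta>))"

definition twice_differentiable :: "(real \<Rightarrow> real) \<Rightarrow> bool" where
  "twice_differentiable F \<longleftrightarrow> (\<forall>x. F differentiable at x \<and> deriv F differentiable at x)"

definition cond_A0 :: "(real \<Rightarrow> real) \<Rightarrow> bool" where
  "cond_A0 F \<longleftrightarrow> range F \<subseteq> {0..1} \<and> strict_mono F \<and> (\<forall>x. F x = 1 - F (- x))"

text \<open>The supremum is taken in \<open>ereal\<close>, so the condition includes its finiteness.\<close>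

definition cond_A1 :: "(real \<Rightarrow> real) \<Rightarrow> real \<Rightarrow> bool" where
  "cond_A1 F \<kappa>\<^sub>1 \<longleftrightarrow> \<kappa>\<^sub>1 > 0 \<and> (SUP x. ereal (deriv F x / (F x * (1 - F x)))) < ereal \<kappa>\<^sub>1"

text \<open>
  The minimum over \<open>\<bar>x\<bar> \<le> 4\<close> exceeding \<open>1 / \<kappa>\<^sub>2\<close> is stated pointwise, because the second derivative
  is not assumed to be continuous and the minimum need not be attained.
\<close>

definition cond_A2 :: "(real \<Rightarrow> real) \<Rightarrow> real \<Rightarrow> bool" where
  "cond_A2 F \<kappa>\<^sub>2 \<longleftrightarrow>
     (let h = deriv (deriv (\<lambda>x. - ln (F x)))
      in (\<forall>x. h x > 0) \<and> \<kappa>\<^sub>2 > 0 \<and> (\<forall>x. h x < \<kappa>\<^sub>2) \<and> (\<forall>x. \<bar>x\<bar> \<le> 4 \<longrightarrow> h x > 1 / \<kappa>\<^sub>2))"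

definition occurrences :: "nat \<Rightarrow> nat \<Rightarrow> 'n dataset \<Rightarrow> 'n \<Rightarrow> 'n \<Rightarrow> (nat \<times> nat) set" where
  "occurrences m L D i j = {(s, l). s \<in> {1..m} \<and> l \<in> {1..L} \<and> fst (D s l) = {i, j}}"

definition num_comparisons :: "nat \<Rightarrow> nat \<Rightarrow> 'n dataset \<Rightarrow> 'n \<Rightarrow> 'n \<Rightarrow> nat" where
  "num_comparisons m L D i j = card (occurrences m L D i j)"

text \<open>For a pair that is never compared this is 0 by the convention on division.\<close>

definition mean_outcome :: "nat \<Rightarrow> nat \<Rightarrow> 'n dataset \<Rightarrow> 'n \<Rightarrow> 'n \<Rightarrow> real" where
  "mean_outcome m L D i j =
     1 / real (num_comparisons m L D i j) *
       (\<Sum>(s, l) \<in> occurrences m L D i j. (1 + snd (D s l)) / 2)"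

definition neg_log_lik ::
    "(real \<Rightarrow> real) \<Rightarrow> nat \<Rightarrow> nat \<Rightarrow> ('n::{finite,linorder}) dataset \<Rightarrow> real ^ ('n::{finite,linorder}) \<Rightarrow> real" where
  "neg_log_lik F m L D \<theta> =
     (\<Sum>(i, j) \<in> {(i, j). i < j}. real (num_comparisons m L D i j) *
        (- mean_outcome m L D i j * ln (F (\<theta> $ i - \<theta> $ j))
         - (1 - mean_outcome m L D i j) * ln (1 - F (\<theta> $ i - \<theta> $ j))))"

definition perturbed_objective ::
    "(real \<Rightarrow> real) \<Rightarrow> nat \<Rightarrow> nat \<Rightarrow> real \<Rightarrow> 'n dataset \<Rightarrow>
      real ^ ('n::{finite,linorder}) \<Rightarrow> real ^ ('n::{finite,linorder}) \<Rightarrow> real"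
  where
  "perturbed_objective F m L \<gamma> D w \<theta> =
     neg_log_lik F m L D \<theta> + \<gamma> / 2 * (norm \<theta>)\<^sup>2 + w \<bullet> \<theta>"

definition perturbed_mle ::
    "(real \<Rightarrow> real) \<Rightarrow> nat \<Rightarrow> nat \<Rightarrow> real \<Rightarrow> 'n dataset \<Rightarrow>
      real ^ ('n::{finite,linorder}) \<Rightarrow> real ^ ('n::{finite,linorder})"
  where
  "perturbed_mle F m L \<gamma> D w = arg_min (perturbed_objective F m L \<gamma> D w) (\<lambda>_. True)"

definition laplace_density :: "real \<Rightarrow> real \<Rightarrow> real" where
  "laplace_density b x = 1 / (2 * b) * exp (- \<bar>x\<bar> / b)"

definition iid_laplace :: "'a measure \<Rightarrow> real \<Rightarrow> ('a \<Rightarrow> real ^ 'n::finite) \<Rightarrow> bool" where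
  "iid_laplace P b w \<longleftrightarrow>
     prob_space.indep_vars P (\<lambda>_. borel) (\<lambda>i \<omega>. w \<omega> $ i) UNIV \<and>
     (\<forall>i. distributed P lborel (\<lambda>\<omega>. w \<omega> $ i) (\<lambda>x. ennreal (laplace_density b x)))"

end

theory Submission
  imports Defs
begin

text \<open>
  With \<open>\<phi> = - ln F\<close>, a comparison contributes \<open>\<phi> (a \<bullet> \<theta>)\<close> to the likelihood, where \<open>a\<close> is plus or minus
  a difference of two unit vectors.  The estimator is the inverse of the map
  \<open>T \<theta> = - (\<Sum>k. \<phi>' (a k \<bullet> \<theta>) a k + \<gamma> \<theta>)\<close>, a differentiable bijection by strong convexity, so its law
  has the density \<open>det H \<cdot> f (T \<theta>)\<close> with \<open>H\<close> the regularised Hessian and \<open>f\<close> the Laplace density.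
  Changing the \<open>L\<close> comparisons of a user moves \<open>T \<theta>\<close> by at most \<open>4 L \<kappa>\<^sub>1\<close> in the 1-norm, which costs
  a factor \<open>exp (\<epsilon> / 2)\<close>, and changes \<open>H\<close> by rank-one updates, each of which multiplies the
  determinant by a factor between 1 and \<open>1 + 2 \<kappa>\<^sub>2 / \<gamma>\<close>, which costs a factor \<open>exp (\<epsilon> / 4)\<close>.
  The second derivative of \<open>F\<close> need not be continuous: the change of variables formula used here
  asks only for differentiability at every point.
\<close>

section \<open>Determinants of finite rank updates\<close>

text \<open>Row \<open>k\<close> equals \<open>v\<close>, so adding \<open>u $ j\<close> times row
  \<open>k\<close> to row \<open>j\<close> is a row operation and leaves the determinant unchanged;
  induction on \<open>S\<close> thus reduces to the identity matrix with one row replaced by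
  \<open>v\<close>.\<close>

lemma det_mat_add_outer_row:
  fixes u v :: "real ^ 'n"
  assumes "finite S" "k \<notin> S"
  shows "det (\<chi> i. if i = k then v else if i \<in> S then axis i 1 + u $ i *s v else axis i 1) = v $ k"
  using assms
proof (induction S rule: finite_induct)
  case empty
  \<comment> \<open>Expanding \<open>v\<close> in the rows of the identity gives the form to which
    Cramer's rule applies.\<close>
  have "(\<Sum>i\<in>UNIV. v $ i *s row i (mat 1 :: real^'n^'n)) = v"
    by (simp add: vec_eq_iff row_def mat_def if_distrib if_distribR cong: if_cong)
  moreover have "row i (mat 1 :: real^'n^'n) = axis i 1" for i
    by (auto simp: vec_eq_iff row_def mat_def axis_def)
  ultimately have "det (\<chi> i. if i = k then v else axis i 1) = v $ k"
    using cramer_lemma_transpose[of k v "mat 1"] by (simp only: det_I mult_1_right)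
  then show ?case by (simp only: empty_iff if_False)
next
  case (insert j S)
  let ?A = "(\<chi> i. if i = k then v else if i \<in> S then axis i 1 + u $ i *s v else axis i 1) :: real^'n^'n"
  have "(\<chi> i. if i = k then v else if i \<in> insert j S then axis i 1 + u $ i *s v else axis i 1)
      = (\<chi> i. if i = j then row j ?A + u $ j *s row k ?A else row i ?A)"
    using insert.hyps insert.prems by (auto simp: vec_eq_iff row_def)
  moreover have "j \<noteq> k" using insert.prems by auto
  ultimately show ?case
    using insert.IH insert.prems det_row_operation[of j k ?A "u $ j"] by simp
qed

text \<open>Modifying the rows one at a time allows induction: linearity in row \<open>k\<close>
  splits the determinant into the one for \<open>S\<close> and \<open>u $ k\<close> times the one of
  the preceding lemma.\<close>

lemma det_mat_add_outer_sum:
  fixes u v :: "real ^ 'n"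
  assumes "finite S"
  shows "det (\<chi> i. if i \<in> S then axis i 1 + u $ i *s v else axis i 1) = 1 + (\<Sum>i\<in>S. u $ i * v $ i)"
  using assms
proof (induction S rule: finite_induct)
  case empty
  have "(\<chi> i. axis i 1) = (mat 1 :: real^'n^'n)"
    by (auto simp: vec_eq_iff mat_def axis_def)
  then show ?case by simp
next
  case (insert k S)
  let ?r = "\<lambda>i. if i \<in> S then axis i 1 + u $ i *s v else axis i 1 :: real^'n"
  have "(\<chi> i. if i \<in> insert k S then axis i 1 + u $ i *s v else axis i 1)
      = (\<chi> i. if i = k then axis k 1 + u $ k *s v else ?r i)"
    by (auto simp: vec_eq_iff)
  moreover have "det (\<chi> i. if i = k then axis k 1 else ?r i) = det (\<chi> i. ?r i)"
    using insert.hyps by (intro arg_cong[where f=det]) (auto simp: vec_eq_iff)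
  moreover note det_mat_add_outer_row[OF insert.hyps, of v u]
  ultimately show ?case
    using insert.IH insert.hyps
    by (simp only: det_row_add[of k "\<lambda>i. axis k 1"] det_row_mul[of k "u $ k" "\<lambda>i. v"]) simp
qed

section \<open>Rank-one matrices and their effect on the determinant\<close>

definition outer :: "real ^ 'n \<Rightarrow> real ^ 'n \<Rightarrow> real ^ 'n ^ 'n" where
  "outer u v = (\<chi> i. u $ i *\<^sub>R v)"

lemma outer_mult_vec: "outer u v *v x = (v \<bullet> x) *\<^sub>R u"
  by (simp add: vec_eq_iff outer_def matrix_vector_mult_def inner_vec_def sum_distrib_right mult_ac
      sum_distrib_left)

lemma outer_sum_mult_vec:
  "(\<Sum>k\<in>K. c k *\<^sub>R outer (v k) (v k)) *v x = (\<Sum>k\<in>K. (c k * (v k \<bullet> x)) *\<^sub>R v k)"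
  by (induction K rule: infinite_finite_induct)
    (auto simp: matrix_vector_mult_add_rdistrib outer_mult_vec simp flip: scaleR_matrix_vector_assoc)

lemma mat_mult_vec: "mat r *v x = r *\<^sub>R (x :: real ^ 'n)"
  by (simp add: vec_eq_iff mat_def matrix_vector_mult_def if_distrib if_distribR cong: if_cong)

lemma matrix_mult_outer: "A ** outer u v = outer (A *v u) v"
  by (simp add: vec_eq_iff outer_def matrix_matrix_mult_def matrix_vector_mult_def
      sum_distrib_left mult_ac)

text \<open>The matrix determinant lemma, obtained by modifying all rows.\<close>

lemma det_mat_add_outer: "det (mat 1 + outer u v) = 1 + u \<bullet> v"
proof -
  have "mat 1 + outer u v = (\<chi> i. if i \<in> UNIV then axis i 1 + u $ i *s v else axis i 1)"
    by (auto simp: vec_eq_iff outer_def mat_def axis_def)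
  then show ?thesis
    using det_mat_add_outer_sum[of UNIV u v] by (simp add: inner_vec_def)
qed

text \<open>With \<open>y\<close> the solution of \<open>A *v y = v\<close>, the updated matrix
  factors as \<open>A ** (mat 1 + outer (c *\<^sub>R y) v)\<close>, so the determinant is multiplied
  by \<open>1 + c * (y \<bullet> v)\<close>. Coercivity at \<open>y\<close> gives
  \<open>y \<bullet> v \<ge> 0\<close> and, with Cauchy-Schwarz, an upper bound.\<close>

lemma det_rank_one_update:
  fixes A :: "real ^ 'n ^ 'n"
  assumes "0 < g" "0 \<le> c" and coercive: "\<And>x. g * (norm x)\<^sup>2 \<le> x \<bullet> (A *v x)" and "0 < det A"
  shows "det A \<le> det (A + c *\<^sub>R outer v v)"
    and "det (A + c *\<^sub>R outer v v) \<le> (1 + c * (norm v)\<^sup>2 / g) * det A"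
proof -
  obtain B where B: "A ** B = mat 1"
    using \<open>0 < det A\<close> invertible_det_nz[of A] unfolding invertible_def by auto
  define y where "y = B *v v"
  have Ay: "A *v y = v"
    by (simp add: y_def matrix_vector_mul_assoc B)
  have yv: "g * (norm y)\<^sup>2 \<le> y \<bullet> v"
    using coercive[of y] Ay by simp
  have nonneg: "0 \<le> y \<bullet> v"
    using yv \<open>0 < g\<close> by (smt (verit) mult_nonneg_nonneg zero_le_power2)
  have "g * norm y \<le> norm v"
  proof (cases "y = 0")
    case False
    have "g * norm y * norm y \<le> norm v * norm y"
      using yv norm_cauchy_schwarz[of y v] by (simp add: power2_eq_square mult_ac)
    then show ?thesis using False by simp
  qed simp
  then have "y \<bullet> v \<le> (norm v)\<^sup>2 / g"
    using norm_cauchy_schwarz[of y v] \<open>0 < g\<close>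
    by (smt (verit) divide_right_mono mult.commute mult_right_mono nonzero_mult_div_cancel_left
        norm_ge_zero power2_eq_square times_divide_eq_left)
  then have le: "c * (y \<bullet> v) \<le> c * (norm v)\<^sup>2 / g"
    using mult_left_mono[OF _ \<open>0 \<le> c\<close>] by fastforce
  have "A + c *\<^sub>R outer v v = A ** (mat 1 + outer (c *\<^sub>R y) v)"
  proof -
    have "c *\<^sub>R outer v v = outer (A *v (c *\<^sub>R y)) v"
      using Ay by (simp add: matrix_vector_mult_scaleR) (simp add: outer_def vec_eq_iff)
    then show ?thesis by (simp add: matrix_add_ldistrib matrix_mult_outer)
  qed
  then have *: "det (A + c *\<^sub>R outer v v) = (1 + c * (y \<bullet> v)) * det A"
    by (simp add: det_mul det_mat_add_outer)
  show "det A \<le> det (A + c *\<^sub>R outer v v)"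
    and "det (A + c *\<^sub>R outer v v) \<le> (1 + c * (norm v)\<^sup>2 / g) * det A"
    unfolding * using nonneg le \<open>0 < det A\<close> \<open>0 \<le> c\<close> by (simp_all add: mult_le_cancel_right1)
qed

text \<open>The added quadratic form is a nonnegative combination of squares. The constant
  \<open>g\<close> therefore survives every update.\<close>

lemma coercive_add_outer_sum:
  fixes A :: "real ^ 'n ^ 'n"
  assumes "\<And>x. g * (norm x)\<^sup>2 \<le> x \<bullet> (A *v x)" "\<And>k. k \<in> K \<Longrightarrow> 0 \<le> c k"
  shows "g * (norm x)\<^sup>2 \<le> x \<bullet> ((A + (\<Sum>k\<in>K. c k *\<^sub>R outer (v k) (v k))) *v x)"
proof -
  have "x \<bullet> ((\<Sum>k\<in>K. c k *\<^sub>R outer (v k) (v k)) *v x) = (\<Sum>k\<in>K. c k * (v k \<bullet> x)\<^sup>2)"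
    by (simp add: outer_sum_mult_vec inner_sum_right power2_eq_square inner_commute mult_ac)
  also have "\<dots> \<ge> 0" by (intro sum_nonneg mult_nonneg_nonneg assms) auto
  finally show ?thesis
    using assms(1)[of x] by (simp add: matrix_vector_mult_add_rdistrib inner_add_right)
qed

text \<open>The updates are made one by one, each with the same coercivity constant. The lower bound
  is carried through the induction because it keeps the determinant positive for the next
  update.\<close>

lemma det_finite_rank_update:
  fixes A :: "real ^ 'n ^ 'n"
  assumes "finite K" "0 < g" and c: "\<And>k. k \<in> K \<Longrightarrow> 0 \<le> c k \<and> c k * (norm (v k))\<^sup>2 \<le> b"
    and coercive: "\<And>x. g * (norm x)\<^sup>2 \<le> x \<bullet> (A *v x)" and "0 < det A"
  shows "det A \<le> det (A + (\<Sum>k\<in>K. c k *\<^sub>R outer (v k) (v k))) \<and>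
         det (A + (\<Sum>k\<in>K. c k *\<^sub>R outer (v k) (v k))) \<le> (1 + b / g) ^ card K * det A"
  using assms(1) c
proof (induction K rule: finite_induct)
  case (insert j K)
  let ?B = "A + (\<Sum>k\<in>K. c k *\<^sub>R outer (v k) (v k))"
  have IH: "det A \<le> det ?B" "det ?B \<le> (1 + b / g) ^ card K * det A"
    using insert by auto
  have j: "0 \<le> c j" "c j * (norm (v j))\<^sup>2 \<le> b"
    using insert.prems by auto
  have "0 \<le> b" using j by (smt (verit) mult_nonneg_nonneg zero_le_power2)
  have cB: "g * (norm x)\<^sup>2 \<le> x \<bullet> (?B *v x)" for x
    using insert.prems coercive by (intro coercive_add_outer_sum) auto
  have "0 < det ?B" using IH \<open>0 < det A\<close> by linarith
  note upd = det_rank_one_update[OF \<open>0 < g\<close> j(1) cB this, of "v j"]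
  have eq: "A + (\<Sum>k\<in>insert j K. c k *\<^sub>R outer (v k) (v k)) = ?B + c j *\<^sub>R outer (v j) (v j)"
    using insert.hyps by (simp add: add_ac)
  have "det (?B + c j *\<^sub>R outer (v j) (v j)) \<le> (1 + b / g) * det ?B"
    using upd(2) j(2) \<open>0 < g\<close> \<open>0 < det ?B\<close>
    by (smt (verit) divide_right_mono mult_right_mono)
  also have "\<dots> \<le> (1 + b / g) * ((1 + b / g) ^ card K * det A)"
    using IH(2) \<open>0 \<le> b\<close> \<open>0 < g\<close> by (intro mult_left_mono) auto
  finally show ?case
    unfolding eq using upd(1) IH(1) insert.hyps by (simp add: mult_ac)
qed simp

section \<open>Regularised estimators with linear perturbation\<close>

text \<open>What the argument asks of the loss: \<open>nonneg\<close> serves the existence of a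
  minimiser, \<open>bound1\<close> controls the shift of the score, \<open>convex\<close> makes the
  score injective, and \<open>convex\<close> with \<open>bound2\<close> controls the
  determinants.\<close>

locale convex_loss =
  fixes \<phi> \<phi>' \<phi>'' :: "real \<Rightarrow> real" and \<kappa>\<^sub>1 \<kappa>\<^sub>2 \<gamma> :: real
  assumes deriv1: "(\<phi> has_real_derivative \<phi>' x) (at x)"
    and deriv2: "(\<phi>' has_real_derivative \<phi>'' x) (at x)"
    and nonneg: "0 \<le> \<phi> x"
    and bound1: "\<bar>\<phi>' x\<bar> \<le> \<kappa>\<^sub>1"
    and convex: "0 \<le> \<phi>'' x"
    and bound2: "\<phi>'' x \<le> \<kappa>\<^sub>2"
    and gamma_pos: "0 < \<gamma>"
begin

text \<open>The data enter as a family \<open>a\<close> of vectors over an index set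
  \<open>K\<close>, so that the comparisons of one user form a subset of \<open>K\<close>.\<close>

definition objective :: "('k \<Rightarrow> 'v::euclidean_space) \<Rightarrow> 'k set \<Rightarrow> 'v \<Rightarrow> 'v \<Rightarrow> real" where
  "objective a K w \<theta> = (\<Sum>k\<in>K. \<phi> (a k \<bullet> \<theta>)) + \<gamma> / 2 * (norm \<theta>)\<^sup>2 + w \<bullet> \<theta>"

text \<open>The negative gradient of the objective without its linear term; with this sign the
  stationarity condition reads \<open>score a K \<theta> = w\<close>.\<close>

definition score :: "('k \<Rightarrow> 'v::euclidean_space) \<Rightarrow> 'k set \<Rightarrow> 'v \<Rightarrow> 'v" where
  "score a K \<theta> = - ((\<Sum>k\<in>K. \<phi>' (a k \<bullet> \<theta>) *\<^sub>R a k) + \<gamma> *\<^sub>R \<theta>)"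

definition estimate :: "('k \<Rightarrow> 'v::euclidean_space) \<Rightarrow> 'k set \<Rightarrow> 'v \<Rightarrow> 'v" where
  "estimate a K w = arg_min (objective a K w) (\<lambda>_. True)"

section \<open>Derivatives and monotonicity\<close>

lemma objective_has_derivative:
  "(objective a K w has_derivative (\<lambda>h. (w - score a K \<theta>) \<bullet> h)) (at \<theta>)"
proof -
  have "((\<lambda>\<theta>. \<phi> (a k \<bullet> \<theta>)) has_derivative (\<lambda>h. \<phi>' (a k \<bullet> \<theta>) * (a k \<bullet> h))) (at \<theta>)" for k
    by (rule has_derivative_compose[OF _ deriv1[unfolded has_field_derivative_def]])
      (auto intro!: derivative_eq_intros)
  moreover have "((\<lambda>\<theta>. \<gamma> / 2 * (norm \<theta>)\<^sup>2) has_derivative (\<lambda>h. \<gamma> * (\<theta> \<bullet> h))) (at \<theta>)"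
    unfolding power2_norm_eq_inner
    by (auto intro!: derivative_eq_intros simp: inner_commute)
  moreover have "((\<lambda>\<theta>. w \<bullet> \<theta>) has_derivative (\<lambda>h. w \<bullet> h)) (at \<theta>)"
    by (auto intro!: derivative_eq_intros)
  ultimately have "(objective a K w has_derivative
      (\<lambda>h. (\<Sum>k\<in>K. \<phi>' (a k \<bullet> \<theta>) * (a k \<bullet> h)) + \<gamma> * (\<theta> \<bullet> h) + w \<bullet> h)) (at \<theta>)"
    unfolding objective_def by (intro has_derivative_add has_derivative_sum)
  then show ?thesis
    by (rule has_derivative_eq_rhs)
      (simp add: score_def fun_eq_iff inner_add_left inner_diff_left inner_sum_left)
qed

lemma score_has_derivative:
  "(score a K has_derivative
     (\<lambda>h. - ((\<Sum>k\<in>K. (\<phi>'' (a k \<bullet> \<theta>) * (a k \<bullet> h)) *\<^sub>R a k) + \<gamma> *\<^sub>R h))) (at \<theta>)"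
proof -
  have "((\<lambda>\<theta>. \<phi>' (a k \<bullet> \<theta>)) has_derivative (\<lambda>h. \<phi>'' (a k \<bullet> \<theta>) * (a k \<bullet> h))) (at \<theta>)" for k
    by (rule has_derivative_compose[OF _ deriv2[unfolded has_field_derivative_def]])
      (auto intro!: derivative_eq_intros)
  then have "((\<lambda>\<theta>. \<phi>' (a k \<bullet> \<theta>) *\<^sub>R a k) has_derivative
      (\<lambda>h. (\<phi>'' (a k \<bullet> \<theta>) * (a k \<bullet> h)) *\<^sub>R a k)) (at \<theta>)" for k
    by (rule has_derivative_scaleR_left)
  then show ?thesis
    unfolding score_def
    by (intro has_derivative_minus has_derivative_add has_derivative_sum has_derivative_scaleR_right
        has_derivative_ident)
qed

text \<open>Convexity makes \<open>\<phi>'\<close> nondecreasing, so every index contributes a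
  nonnegative term, and the regulariser contributes the left-hand side exactly.\<close>

lemma score_strongly_monotone:
  "\<gamma> * (norm (x - y))\<^sup>2 \<le> (score a K y - score a K x) \<bullet> (x - y)"
proof -
  have "mono \<phi>'"
  proof (rule monoI)
    fix s t :: real assume "s \<le> t"
    then show "\<phi>' s \<le> \<phi>' t"
      by (rule DERIV_nonneg_imp_nondecreasing) (intro exI conjI, rule deriv2, rule convex)
  qed
  have mono: "0 \<le> (\<phi>' s - \<phi>' t) * (s - t)" for s t
  proof (cases "s \<le> t")
    case True
    then show ?thesis
      using monoD[OF \<open>mono \<phi>'\<close> True] by (simp add: mult_nonpos_nonpos)
  next
    case False
    then show ?thesis
      using monoD[OF \<open>mono \<phi>'\<close>, of t s] by simp
  qed
  have "0 \<le> (\<Sum>k\<in>K. (\<phi>' (a k \<bullet> x) - \<phi>' (a k \<bullet> y)) * (a k \<bullet> x - a k \<bullet> y))"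
    by (intro sum_nonneg mono)
  also have "\<dots> = (\<Sum>k\<in>K. \<phi>' (a k \<bullet> x) *\<^sub>R a k - \<phi>' (a k \<bullet> y) *\<^sub>R a k) \<bullet> (x - y)"
    unfolding inner_sum_left by (intro sum.cong refl) (simp add: inner_diff algebra_simps)
  also have "(\<Sum>k\<in>K. \<phi>' (a k \<bullet> x) *\<^sub>R a k - \<phi>' (a k \<bullet> y) *\<^sub>R a k)
      = (score a K y - score a K x) - \<gamma> *\<^sub>R (x - y)"
    by (simp add: score_def sum_subtractf algebra_simps)
  finally show ?thesis
    by (simp add: inner_diff_left power2_norm_eq_inner)
qed

lemma inj_score: "inj (score a K)"
proof (rule injI)
  fix x y assume "score a K x = score a K y"
  then have "\<gamma> * (norm (x - y))\<^sup>2 \<le> 0"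
    using score_strongly_monotone[of x y a K] by simp
  then show "x = y"
    using gamma_pos by (simp add: mult_le_0_iff not_le)
qed

text \<open>Outside a large ball the quadratic term dominates and the objective is at least its
  value at 0; inside, compactness gives a minimum.\<close>

lemma ex_minimizer: "\<exists>x. \<forall>y. objective a K w x \<le> objective a K w y"
proof -
  let ?J = "objective a K w"
  define c where "c = (\<Sum>k\<in>K. \<phi> 0)"
  \<comment> \<open>Beyond this radius the quadratic term is at least
    \<open>(norm w + c + 1) * norm y\<close>, which outweighs the linear term and leaves
    \<open>(c + 1) * norm y\<close>. The final 1 in \<open>R\<close> ensures
    \<open>norm y \<ge> 1\<close>, and \<open>c\<close> is the objective at 0.\<close>
  define R where "R = 2 * (norm w + c + 1) / \<gamma> + 1"
  have "0 \<le> c" unfolding c_def by (intro sum_nonneg nonneg)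
  then have "1 \<le> R" using gamma_pos unfolding R_def by auto
  have far: "?J 0 \<le> ?J y" if "R < norm y" for y
  proof -
    have "norm w + c + 1 \<le> \<gamma> / 2 * norm y"
      using that gamma_pos unfolding R_def by (simp add: field_simps)
    then have "(norm w + c + 1) * norm y \<le> \<gamma> / 2 * norm y * norm y"
      by (rule mult_right_mono) simp
    moreover have "(c + 1) * 1 \<le> (c + 1) * norm y"
      using that \<open>1 \<le> R\<close> \<open>0 \<le> c\<close> by (intro mult_left_mono) auto
    moreover have "- (norm w * norm y) \<le> w \<bullet> y"
      using Cauchy_Schwarz_ineq2[of w y] by linarith
    ultimately have "c \<le> \<gamma> / 2 * (norm y)\<^sup>2 + w \<bullet> y"
      by (simp add: algebra_simps power2_eq_square)
    moreover have "0 \<le> (\<Sum>k\<in>K. \<phi> (a k \<bullet> y))"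
      by (intro sum_nonneg nonneg)
    ultimately show ?thesis by (simp add: objective_def c_def)
  qed
  have "continuous_on (cball 0 R) ?J"
    by (meson continuous_at_imp_continuous_on has_derivative_continuous objective_has_derivative)
  then obtain x where x: "x \<in> cball 0 R" "\<And>y. y \<in> cball 0 R \<Longrightarrow> ?J x \<le> ?J y"
    using continuous_attains_inf[OF compact_cball, of 0 R ?J] \<open>1 \<le> R\<close> by auto
  have "?J x \<le> ?J y" for y
    using x(2)[of y] x(2)[of 0] far[of y] \<open>1 \<le> R\<close> by (cases "norm y \<le> R") auto
  then show ?thesis by blast
qed

text \<open>The derivative vanishes at a minimiser; evaluated in the direction
  \<open>w - score a K x\<close> it is the squared norm of that vector.\<close>

lemma score_minimizer:
  assumes "\<And>y. objective a K w x \<le> objective a K w y"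
  shows "score a K x = w"
proof -
  have "(\<lambda>h. (w - score a K x) \<bullet> h) = (\<lambda>h. 0)"
    using assms by (intro differential_zero_maxmin[OF UNIV_I open_UNIV objective_has_derivative]) auto
  then have "(w - score a K x) \<bullet> (w - score a K x) = 0"
    by metis
  then show ?thesis by simp
qed

lemma estimate_minimizes: "objective a K w (estimate a K w) \<le> objective a K w y"
proof -
  have "is_arg_min (objective a K w) (\<lambda>_. True) (estimate a K w)"
    unfolding estimate_def arg_min_def
    using ex_minimizer[of a K w] by (intro someI_ex[of "is_arg_min _ _"]) (auto simp: is_arg_min_linorder)
  then show ?thesis by (simp add: is_arg_min_linorder)
qed

lemma score_estimate: "score a K (estimate a K w) = w"
  by (intro score_minimizer estimate_minimizes)

text \<open>Together with \<open>score_estimate\<close>, this makes the score a bijection with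
  inverse \<open>estimate a K\<close>.\<close>

lemma estimate_score: "estimate a K (score a K x) = x"
  by (rule injD[OF inj_score[of a K]]) (rule score_estimate)

lemma estimate_eqI: "(\<And>y. objective a K w x \<le> objective a K w y) \<Longrightarrow> estimate a K w = x"
  using score_minimizer estimate_score by metis

text \<open>Turns an event about the estimator into an image under the score, as the change of
  variables requires.\<close>

lemma vimage_estimate: "estimate a K -` B = score a K ` B"
proof (intro equalityI subsetI)
  fix w assume "w \<in> estimate a K -` B"
  then show "w \<in> score a K ` B"
    by (intro image_eqI[of _ _ "estimate a K w"]) (simp_all add: score_estimate)
qed (auto simp: estimate_score)

text \<open>Strong monotonicity of the score, combined with Cauchy-Schwarz, says that its inverse is
  Lipschitz with constant \<open>1 / \<gamma>\<close>.\<close>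

lemma continuous_estimate: "continuous_on UNIV (estimate a K)"
proof (rule lipschitz_on_continuous_on)
  show "(1 / \<gamma>)-lipschitz_on UNIV (estimate a K)"
  proof (rule lipschitz_onI)
    fix v w
    let ?x = "estimate a K v" and ?y = "estimate a K w"
    have "\<gamma> * norm (?x - ?y) * norm (?x - ?y) \<le> norm (w - v) * norm (?x - ?y)"
      using score_strongly_monotone[of ?x ?y a K] norm_cauchy_schwarz[of "w - v" "?x - ?y"]
      by (simp add: score_estimate power2_eq_square mult_ac)
    then have "\<gamma> * norm (?x - ?y) \<le> norm (w - v)"
      using gamma_pos by (cases "?x = ?y") auto
    then show "dist ?x ?y \<le> 1 / \<gamma> * dist v w"
      using gamma_pos by (simp add: dist_norm norm_minus_commute field_simps)
  qed (use gamma_pos in auto)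
qed

lemma measurable_estimate [measurable]: "estimate a K \<in> borel_measurable borel"
  by (rule borel_measurable_continuous_onI[OF continuous_estimate])

end

section \<open>Change of variables and the Laplace density\<close>

text \<open>Links probabilities under a density with the integral \<open>integral C f\<close> in
  which the change of variables is phrased.\<close>

lemma integral_density_real:
  fixes f :: "'v::euclidean_space \<Rightarrow> real"
  assumes f: "integrable lborel f" "\<And>x. 0 \<le> f x" and C: "C \<in> sets borel"
  shows "f absolutely_integrable_on C"
    and "integral C f = measure (density lborel (\<lambda>x. ennreal (f x))) C"
proof -
  have set: "set_integrable lborel C f"
    unfolding set_integrable_def using f(1) C by (intro integrable_mult_indicator) auto
  show "f absolutely_integrable_on C"
    using set unfolding set_integrable_def by (rule integrable_completion[THEN iffD2, rotated]) (use set in \<open>auto simp: set_integrable_def\<close>)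
  have "emeasure (density lborel (\<lambda>x. ennreal (f x))) C = (\<integral>\<^sup>+x. ennreal (indicator C x *\<^sub>R f x) \<partial>lborel)"
    using f C by (subst emeasure_density) (auto intro!: nn_integral_cong simp: indicator_def)
  also have "\<dots> = ennreal (set_lebesgue_integral lborel C f)"
    unfolding set_lebesgue_integral_def using set f(2)
    by (intro nn_integral_eq_integral) (auto simp: set_integrable_def)
  moreover have "0 \<le> set_lebesgue_integral lborel C f"
    unfolding set_lebesgue_integral_def using f(2) by (intro Bochner_Integration.integral_nonneg) simp
  ultimately show "integral C f = measure (density lborel (\<lambda>x. ennreal (f x))) C"
    using set_borel_integral_eq_integral(2)[OF set] by (simp add: measure_def)
qed

text \<open>The formula for vector-valued integrands, applied to \<open>f\<close> viewed as a map
  into \<open>real^1\<close>.\<close>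

lemma change_of_variables_real:
  fixes f :: "real ^ 'n::{finite,wellorder} \<Rightarrow> real" and g :: "real ^ 'n::_ \<Rightarrow> real ^ 'n::_"
  assumes "S \<in> sets lebesgue"
    and "\<And>x. x \<in> S \<Longrightarrow> (g has_derivative g' x) (at x within S)"
    and "inj_on g S"
    and "f absolutely_integrable_on g ` S"
  shows "(\<lambda>x. \<bar>det (matrix (g' x))\<bar> * f (g x)) absolutely_integrable_on S"
    and "integral S (\<lambda>x. \<bar>det (matrix (g' x))\<bar> * f (g x)) = integral (g ` S) f"
  using has_absolute_integral_change_of_variables[OF assms(1-3),
      of "\<lambda>x. vec (f x) :: real^1" "vec (integral (g ` S) f)"] assms(4)
  by (auto simp: absolutely_integrable_on_1_iff integral_on_1_eq)

text \<open>Negating every row contributes only a sign. This is needed because the Jacobian of the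
  score is minus the Hessian.\<close>

lemma det_uminus_abs: "\<bar>det (- A)\<bar> = \<bar>det (A :: real ^ 'n ^ 'n)\<bar>"
proof -
  have "- A = (\<chi> i. (- 1) *s A $ i)" by (simp add: vec_eq_iff)
  then have "det (- A) = (\<Prod>i\<in>(UNIV::'n set). - 1) * det (\<chi> i. A $ i)"
    by (simp only: det_rows_mul)
  then show ?thesis by (simp add: abs_mult power_abs)
qed

lemma prod_Basis_vec: "(\<Prod>b\<in>(Basis :: (real ^ 'n) set). h b) = (\<Prod>i\<in>UNIV. h (axis i 1))"
proof -
  have "(Basis :: (real ^ 'n) set) = range (\<lambda>i. axis i 1)"
    by (auto simp: Basis_vec_def)
  then have "(\<Prod>b\<in>(Basis :: (real ^ 'n) set). h b) = (\<Prod>b\<in>range (\<lambda>i. axis i 1). h b)"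
    by (rule arg_cong)
  also have "\<dots> = (\<Prod>i\<in>UNIV. h (axis i 1))"
    by (subst prod.reindex) (auto simp: inj_on_def axis_eq_axis)
  finally show ?thesis .
qed

section \<open>The multivariate Laplace density\<close>

abbreviation laplace_density_vec :: "real \<Rightarrow> real ^ 'n \<Rightarrow> real" where
  "laplace_density_vec b x \<equiv> \<Prod>i\<in>UNIV. laplace_density b (x $ i)"

lemma laplace_density_nonneg: "0 < b \<Longrightarrow> 0 \<le> laplace_density b x"
  by (simp add: laplace_density_def)

lemma measurable_laplace_density [measurable]: "laplace_density b \<in> borel_measurable borel"
  unfolding laplace_density_def[abs_def] by measurable

text \<open>Open boxes generate the Borel sets and are closed under intersection, so it suffices to
  compare both measures on boxes, where independence yields a product. The bijection
  \<open>r\<close> relabels the coordinates.\<close>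

lemma iid_laplace_joint_density:
  fixes w :: "'a \<Rightarrow> real ^ 'n" and r :: "'m::finite \<Rightarrow> 'n"
  assumes "prob_space P" "iid_laplace P b w" "0 < b" "bij r"
  shows "(\<lambda>\<omega>. \<chi> j. w \<omega> $ r j) \<in> borel_measurable P"
    and "distr P borel (\<lambda>\<omega>. \<chi> j. w \<omega> $ r j) =
         density lborel (\<lambda>x. ennreal (laplace_density_vec b x))"
proof -
  interpret prob_space P by fact
  have ind: "indep_vars (\<lambda>_. borel) (\<lambda>i \<omega>. w \<omega> $ i) UNIV"
    and dens: "\<And>i. distributed P lborel (\<lambda>\<omega>. w \<omega> $ i) (\<lambda>x. ennreal (laplace_density b x))"
    using assms by (auto simp: iid_laplace_def)
  have [measurable]: "(\<lambda>\<omega>. w \<omega> $ i) \<in> borel_measurable P" for i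
    using distributed_measurable[OF dens[of i]] by simp
  let ?W = "\<lambda>\<omega>. (\<chi> j. w \<omega> $ r j) :: real ^ 'm"
  show W [measurable]: "?W \<in> borel_measurable P"
    by (subst borel_measurable_euclidean_space) (auto simp: Basis_vec_def inner_axis)
  show "distr P borel ?W = density lborel (\<lambda>x. ennreal (laplace_density_vec b x))" (is "?L = ?R")
  proof (rule measure_eqI_generator_eq)
    let ?E = "range (\<lambda>(a, b). box a b :: (real ^ 'm) set)"
    show "Int_stable ?E" by (auto simp: Int_stable_def box_Int_box)
    show "?E \<subseteq> Pow UNIV" "sets ?L = sigma_sets UNIV ?E" "sets ?R = sigma_sets UNIV ?E"
      by (simp_all add: borel_eq_box)
    let ?A = "\<lambda>n::nat. box (- (real n *\<^sub>R One)) (real n *\<^sub>R One) :: (real ^ 'm) set"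
    show "range ?A \<subseteq> ?E" "(\<Union>i. ?A i) = UNIV"
      unfolding UN_box_eq_UNIV by auto
    interpret L: prob_space ?L by (rule prob_space_distr) (rule W)
    show "emeasure ?L (?A i) \<noteq> \<infinity>" for i by simp
    show "emeasure ?L X = emeasure ?R X" if "X \<in> ?E" for X
    proof -
      from that obtain l u where X: "X = box l u" by auto
      let ?I = "\<lambda>j. {l $ j <..< u $ j}"
      have "emeasure ?L X = emeasure P (?W -` X \<inter> space P)"
        unfolding X by (rule emeasure_distr) auto
      \<comment> \<open>The conditions are reindexed along \<open>inv r\<close>, so that they
        concern the coordinates of \<open>w\<close> itself and its independence applies.\<close>
      also have "?W -` X \<inter> space P = (\<Inter>i\<in>UNIV. (\<lambda>\<omega>. w \<omega> $ i) -` ?I (inv r i) \<inter> space P)"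
      proof -
        have "(\<forall>j. w \<omega> $ r j \<in> ?I j) \<longleftrightarrow> (\<forall>i. w \<omega> $ i \<in> ?I (inv r i))" for \<omega>
          using \<open>bij r\<close> by (metis bij_inv_eq_iff)
        then show ?thesis by (auto simp: X mem_box_cart)
      qed
      also have "emeasure P \<dots> = (\<Prod>i\<in>UNIV. emeasure P ((\<lambda>\<omega>. w \<omega> $ i) -` ?I (inv r i) \<inter> space P))"
        using indep_varsD_finite[OF ind, of "\<lambda>i. ?I (inv r i)"]
        by (simp add: emeasure_eq_measure prod_ennreal)
      also have "\<dots> = (\<Prod>i\<in>UNIV. \<integral>\<^sup>+x. ennreal (laplace_density b x) * indicator (?I (inv r i)) x \<partial>lborel)"
        by (intro prod.cong refl distributed_emeasure[OF dens]) simp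
      also have "\<dots> = (\<Prod>j\<in>UNIV. \<integral>\<^sup>+x. ennreal (laplace_density b x) * indicator (?I j) x \<partial>lborel)"
        using \<open>bij r\<close> by (intro prod.reindex_bij_betw) (rule bij_imp_bij_inv)
      also have "\<dots> = (\<Prod>e\<in>Basis. \<integral>\<^sup>+x. ennreal (laplace_density b x * indicator {l \<bullet> e <..< u \<bullet> e} x) \<partial>lborel)"
        using \<open>0 < b\<close> by (simp add: prod_Basis_vec inner_axis ennreal_mult' laplace_density_nonneg ennreal_indicator)
      \<comment> \<open>Tonelli: the product of one-dimensional integrals becomes one integral over
        the whole space.\<close>
      also have "\<dots> = (\<integral>\<^sup>+x. (\<Prod>e\<in>Basis. ennreal (laplace_density b (x \<bullet> e) * indicator {l \<bullet> e <..< u \<bullet> e} (x \<bullet> e))) \<partial>lborel)"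
        using \<open>0 < b\<close> by (intro nn_integral_lborel_prod[symmetric]) auto
      also have "\<dots> = (\<integral>\<^sup>+x. ennreal (laplace_density_vec b x) * indicator X x \<partial>lborel)"
      proof (intro nn_integral_cong)
        fix x :: "real ^ 'm"
        have "(\<Prod>i\<in>UNIV. indicator (?I i) (x $ i)) = (indicator X x :: real)"
          by (auto simp: X mem_box_cart indicator_def prod.If_cases not_less)
        moreover have "(\<Prod>e\<in>Basis. ennreal (laplace_density b (x \<bullet> e) * indicator {l \<bullet> e <..< u \<bullet> e} (x \<bullet> e)))
            = ennreal (laplace_density_vec b x * (\<Prod>i\<in>UNIV. indicator (?I i) (x $ i)))"
          using \<open>0 < b\<close>
          by (simp add: prod_Basis_vec inner_axis prod_ennreal laplace_density_nonneg prod.distrib)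
        ultimately show "(\<Prod>e\<in>Basis. ennreal (laplace_density b (x \<bullet> e) * indicator {l \<bullet> e <..< u \<bullet> e} (x \<bullet> e)))
            = ennreal (laplace_density_vec b x) * indicator X x"
          by (auto simp: indicator_def)
      qed
      also have "\<dots> = emeasure ?R X"
        unfolding X by (intro emeasure_density[symmetric]) auto
      finally show ?thesis .
    qed
  qed
qed

text \<open>By the triangle inequality in each coordinate, the logarithm of the density is Lipschitz
  in the 1-norm with constant \<open>1 / b\<close>.\<close>

lemma laplace_density_vec_le:
  assumes "0 < b"
  shows "laplace_density_vec b x \<le> exp ((\<Sum>i\<in>UNIV. \<bar>x $ i - y $ i\<bar>) / b) * laplace_density_vec b y"
proof -
  have "laplace_density b s \<le> exp (\<bar>s - t\<bar> / b) * laplace_density b t" for s t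
  proof -
    have "- \<bar>s\<bar> / b \<le> \<bar>s - t\<bar> / b + - \<bar>t\<bar> / b"
      using assms by (simp add: field_simps)
    then have "exp (- \<bar>s\<bar> / b) \<le> exp (\<bar>s - t\<bar> / b) * exp (- \<bar>t\<bar> / b)"
      by (simp flip: exp_add)
    then show ?thesis
      using assms by (simp add: laplace_density_def divide_right_mono)
  qed
  then have "laplace_density_vec b x \<le> (\<Prod>i\<in>UNIV. exp (\<bar>x $ i - y $ i\<bar> / b) * laplace_density b (y $ i))"
    using assms by (intro prod_mono) (auto simp: laplace_density_nonneg)
  then show ?thesis
    by (simp add: prod.distrib exp_sum sum_divide_distrib)
qed

section \<open>The law of the estimator\<close>

context convex_loss begin

definition hessian :: "('k \<Rightarrow> real ^ 'n) \<Rightarrow> 'k set \<Rightarrow> real ^ 'n \<Rightarrow> real ^ 'n ^ 'n" where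
  "hessian a K \<theta> = mat \<gamma> + (\<Sum>k\<in>K. \<phi>'' (a k \<bullet> \<theta>) *\<^sub>R outer (a k) (a k))"

lemma score_has_derivative_hessian: "(score a K has_derivative (*v) (- hessian a K \<theta>)) (at \<theta>)"
proof -
  have "- hessian a K \<theta> *v h = - (hessian a K \<theta> *v h)" for h
    by (simp add: vec_eq_iff matrix_vector_mult_def sum_negf)
  then have "(*v) (- hessian a K \<theta>) =
      (\<lambda>h. - ((\<Sum>k\<in>K. (\<phi>'' (a k \<bullet> \<theta>) * (a k \<bullet> h)) *\<^sub>R a k) + \<gamma> *\<^sub>R h))"
    by (simp add: fun_eq_iff hessian_def matrix_vector_mult_add_rdistrib outer_sum_mult_vec mat_mult_vec)
  then show ?thesis
    using score_has_derivative[of a K \<theta>] by (simp only:)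
qed

lemma hessian_coercive: "\<gamma> * (norm x)\<^sup>2 \<le> x \<bullet> (hessian a K \<theta> *v x)"
  unfolding hessian_def
proof (rule coercive_add_outer_sum)
  fix x :: "real ^ 'n"
  show "\<gamma> * (norm x)\<^sup>2 \<le> x \<bullet> (mat \<gamma> *v x)"
    by (simp add: mat_mult_vec power2_norm_eq_inner)
qed (rule convex)

text \<open>Each index in \<open>K'\<close> is a rank-one update with coefficient between 0 and
  \<open>\<kappa>\<^sub>2\<close>. The first bound allows indices to be added at no loss, the second
  limits the gain.\<close>

lemma det_hessian_Un:
  assumes "finite K" "finite K'" "K \<inter> K' = {}" "0 < det (hessian a K \<theta>)"
    and norm: "\<And>k. k \<in> K' \<Longrightarrow> (norm (a k))\<^sup>2 \<le> r"
  shows "det (hessian a K \<theta>) \<le> det (hessian a (K \<union> K') \<theta>)"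
    and "det (hessian a (K \<union> K') \<theta>) \<le> (1 + \<kappa>\<^sub>2 * r / \<gamma>) ^ card K' * det (hessian a K \<theta>)"
proof -
  have "0 \<le> \<phi>'' (a k \<bullet> \<theta>) \<and> \<phi>'' (a k \<bullet> \<theta>) * (norm (a k))\<^sup>2 \<le> \<kappa>\<^sub>2 * r" if "k \<in> K'" for k
    using convex bound2 norm[OF that] by (auto intro!: mult_mono order_trans[OF convex bound2])
  moreover have "hessian a (K \<union> K') \<theta> =
      hessian a K \<theta> + (\<Sum>k\<in>K'. \<phi>'' (a k \<bullet> \<theta>) *\<^sub>R outer (a k) (a k))"
    using assms(1-3) by (simp add: hessian_def sum.union_disjoint add_ac)
  ultimately show "det (hessian a K \<theta>) \<le> det (hessian a (K \<union> K') \<theta>)"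
    and "det (hessian a (K \<union> K') \<theta>) \<le> (1 + \<kappa>\<^sub>2 * r / \<gamma>) ^ card K' * det (hessian a K \<theta>)"
    using det_finite_rank_update[OF \<open>finite K'\<close> gamma_pos _ hessian_coercive \<open>0 < det (hessian a K \<theta>)\<close>,
        of "\<lambda>k. \<phi>'' (a k \<bullet> \<theta>)" a "\<kappa>\<^sub>2 * r"]
    by auto
qed

text \<open>Without data the Hessian is \<open>\<gamma>\<close> times the identity, and adding the
  indices of \<open>K\<close> does not decrease the determinant.\<close>

lemma det_hessian_pos:
  fixes a :: "'k \<Rightarrow> real ^ 'n"
  assumes "finite K"
  shows "0 < det (hessian a K \<theta>)"
proof -
  have "hessian a {} \<theta> = (\<chi> i. \<gamma> *s (mat 1 :: real ^ 'n ^ 'n) $ i)"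
    by (simp add: hessian_def vec_eq_iff mat_def)
  then have "det (hessian a {} \<theta>) = (\<Prod>i\<in>(UNIV::'n set). \<gamma>) * det (\<chi> i. (mat 1 :: real ^ 'n ^ 'n) $ i)"
    by (simp only: det_rows_mul)
  then have pos: "0 < det (hessian a {} \<theta>)"
    using gamma_pos by simp
  obtain r where "\<And>k. k \<in> K \<Longrightarrow> (norm (a k))\<^sup>2 \<le> r"
    using finite_imageI[OF assms, of "\<lambda>k. (norm (a k))\<^sup>2"] by (meson Max_ge imageI)
  from det_hessian_Un(1)[OF finite.emptyI assms _ pos this] pos show ?thesis
    by simp
qed

text \<open>The estimator lies in \<open>B\<close> exactly when the noise lies in the image of
  \<open>B\<close> under the score; the substitution of \<open>score a K x\<close> for the noise
  then produces the Jacobian factor.\<close>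

lemma measure_estimate:
  fixes a :: "'k \<Rightarrow> real ^ 'n::{finite,wellorder}"
  assumes f: "integrable lborel f" "\<And>x. 0 \<le> f x"
    and W: "W \<in> borel_measurable P" "distr P borel W = density lborel (\<lambda>x. ennreal (f x))"
    and "finite K" and B: "B \<in> sets borel"
  shows "(\<lambda>x. det (hessian a K x) * f (score a K x)) absolutely_integrable_on B"
    and "measure (distr P borel (\<lambda>\<omega>. estimate a K (W \<omega>))) B =
         integral B (\<lambda>x. det (hessian a K x) * f (score a K x))"
proof -
  have C: "score a K ` B \<in> sets borel"
    using measurable_sets[OF measurable_estimate[of a K] B] by (simp add: vimage_estimate)
  have "measure (distr P borel (\<lambda>\<omega>. estimate a K (W \<omega>))) B
      = measure (distr (distr P borel W) borel (estimate a K)) B"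
    using W(1) by (simp add: distr_distr o_def)
  also have "\<dots> = measure (density lborel (\<lambda>x. ennreal (f x))) (score a K ` B)"
    using B W(2) by (simp add: measure_distr vimage_estimate)
  also have "\<dots> = integral (score a K ` B) f"
    by (rule integral_density_real(2)[OF f C, symmetric])
  finally have eq: "measure (distr P borel (\<lambda>\<omega>. estimate a K (W \<omega>))) B = integral (score a K ` B) f" .
  \<comment> \<open>The sign of the Jacobian is lost in the absolute value, and the Hessian has
    positive determinant.\<close>
  have det: "\<bar>det (matrix ((*v) (- hessian a K x)))\<bar> = det (hessian a K x)" for x
    using det_hessian_pos[OF \<open>finite K\<close>, of a x] by (simp add: det_uminus_abs)
  have "B \<in> sets lebesgue" using B by simp
  note cov = change_of_variables_real[OF this has_derivative_at_withinI[OF score_has_derivative_hessian]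
      inj_on_subset[OF inj_score subset_UNIV] integral_density_real(1)[OF f C], unfolded det]
  show "(\<lambda>x. det (hessian a K x) * f (score a K x)) absolutely_integrable_on B"
    by (rule cov(1))
  show "measure (distr P borel (\<lambda>\<omega>. estimate a K (W \<omega>))) B =
      integral B (\<lambda>x. det (hessian a K x) * f (score a K x))"
    unfolding eq by (rule cov(2)[symmetric])
qed

text \<open>The regulariser and the indices of \<open>K\<close> cancel. Each index of
  \<open>K'\<close> leaves one term from either data set, of 1-norm at most
  \<open>\<kappa>\<^sub>1 * r\<close>, whence the factor 2.\<close>

lemma score_Un_diff:
  fixes a a' :: "'k \<Rightarrow> real ^ 'n"
  assumes "finite K" "finite K'" "K \<inter> K' = {}" "\<And>k. k \<in> K \<Longrightarrow> a k = a' k"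
    and l1: "\<And>k. k \<in> K' \<Longrightarrow> (\<Sum>i\<in>UNIV. \<bar>a k $ i\<bar>) \<le> r" "\<And>k. k \<in> K' \<Longrightarrow> (\<Sum>i\<in>UNIV. \<bar>a' k $ i\<bar>) \<le> r"
  shows "(\<Sum>i\<in>UNIV. \<bar>score a (K \<union> K') x $ i - score a' (K \<union> K') x $ i\<bar>) \<le> 2 * \<kappa>\<^sub>1 * r * real (card K')"
proof -
  have bound: "(\<Sum>i\<in>UNIV. \<bar>\<phi>' t * v $ i\<bar>) \<le> \<kappa>\<^sub>1 * r" if "(\<Sum>i\<in>UNIV. \<bar>v $ i\<bar>) \<le> r" for t and v :: "real ^ 'n"
  proof -
    have "(\<Sum>i\<in>UNIV. \<bar>\<phi>' t * v $ i\<bar>) = \<bar>\<phi>' t\<bar> * (\<Sum>i\<in>UNIV. \<bar>v $ i\<bar>)"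
      by (simp add: abs_mult sum_distrib_left)
    also have "\<dots> \<le> \<kappa>\<^sub>1 * r"
      using bound1[of t] that by (intro mult_mono) (auto intro: sum_nonneg)
    finally show ?thesis .
  qed
  have "(\<Sum>k\<in>K. \<phi>' (a k \<bullet> x) *\<^sub>R a k) = (\<Sum>k\<in>K. \<phi>' (a' k \<bullet> x) *\<^sub>R a' k)"
    using assms(4) by (intro sum.cong) auto
  then have "score a (K \<union> K') x - score a' (K \<union> K') x =
      (\<Sum>k\<in>K'. \<phi>' (a' k \<bullet> x) *\<^sub>R a' k - \<phi>' (a k \<bullet> x) *\<^sub>R a k)"
    using assms(1-3) by (simp add: score_def sum.union_disjoint sum_subtractf)
  then have "score a (K \<union> K') x $ i - score a' (K \<union> K') x $ i =
      (\<Sum>k\<in>K'. \<phi>' (a' k \<bullet> x) * a' k $ i - \<phi>' (a k \<bullet> x) * a k $ i)" for i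
    by (simp add: vec_eq_iff)
  then have "(\<Sum>i\<in>UNIV. \<bar>score a (K \<union> K') x $ i - score a' (K \<union> K') x $ i\<bar>)
      \<le> (\<Sum>i\<in>UNIV. \<Sum>k\<in>K'. \<bar>\<phi>' (a' k \<bullet> x) * a' k $ i\<bar> + \<bar>\<phi>' (a k \<bullet> x) * a k $ i\<bar>)"
    by (auto intro!: sum_mono order_trans[OF sum_abs])
  also have "\<dots> = (\<Sum>k\<in>K'. (\<Sum>i\<in>UNIV. \<bar>\<phi>' (a' k \<bullet> x) * a' k $ i\<bar>) + (\<Sum>i\<in>UNIV. \<bar>\<phi>' (a k \<bullet> x) * a k $ i\<bar>))"
    by (subst sum.swap) (simp add: sum.distrib)
  also have "\<dots> \<le> (\<Sum>k\<in>K'. \<kappa>\<^sub>1 * r + \<kappa>\<^sub>1 * r)"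
    by (intro sum_mono add_mono bound l1)
  finally show ?thesis by (simp add: mult_ac)
qed

text \<open>The two output densities are compared pointwise at the same output and then integrated
  over \<open>B\<close>. Each index of \<open>K'\<close> costs
  \<open>2 * \<kappa>\<^sub>1 * r / b\<close> for the noise density and
  \<open>\<kappa>\<^sub>2 * q / \<gamma>\<close> for the determinant.\<close>

lemma estimate_distr_ratio:
  fixes a a' :: "'k \<Rightarrow> real ^ 'n::{finite,wellorder}"
  assumes "finite K" "finite K'" "K \<inter> K' = {}" "\<And>k. k \<in> K \<Longrightarrow> a k = a' k"
    and l1: "\<And>k. k \<in> K' \<Longrightarrow> (\<Sum>i\<in>UNIV. \<bar>a k $ i\<bar>) \<le> r" "\<And>k. k \<in> K' \<Longrightarrow> (\<Sum>i\<in>UNIV. \<bar>a' k $ i\<bar>) \<le> r"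
    and l2: "\<And>k. k \<in> K' \<Longrightarrow> (norm (a k))\<^sup>2 \<le> q" and "0 \<le> q"
    and "0 < b" and "prob_space P"
    and W: "W \<in> borel_measurable P"
      "distr P borel W = density lborel (\<lambda>x. ennreal (laplace_density_vec b x))"
    and B: "B \<in> sets borel"
  shows "measure (distr P borel (\<lambda>\<omega>. estimate a (K \<union> K') (W \<omega>))) B
    \<le> exp (real (card K') * (2 * \<kappa>\<^sub>1 * r / b + \<kappa>\<^sub>2 * q / \<gamma>)) *
       measure (distr P borel (\<lambda>\<omega>. estimate a' (K \<union> K') (W \<omega>))) B"
proof -
  let ?f = "laplace_density_vec b :: real ^ 'n::{finite,wellorder} \<Rightarrow> real"
  let ?c = "exp (real (card K') * (2 * \<kappa>\<^sub>1 * r / b + \<kappa>\<^sub>2 * q / \<gamma>))"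
  interpret prob_space P by fact
  have nonneg: "0 \<le> ?f x" for x
    using \<open>0 < b\<close> by (simp add: prod_nonneg laplace_density_nonneg)
  \<comment> \<open>The density has total mass 1 because it is the density of the law of
    \<open>W\<close>.\<close>
  have int: "integrable lborel ?f"
  proof (rule integrableI_nonneg)
    interpret D: prob_space "distr P borel W" by (rule prob_space_distr) (rule W)
    have "emeasure (density lborel (\<lambda>x. ennreal (?f x))) UNIV = 1"
      using D.emeasure_space_1 by (simp add: W(2))
    then show "(\<integral>\<^sup>+x. ennreal (?f x) \<partial>lborel) < \<infinity>"
      by (simp add: emeasure_density)
  qed (use nonneg in auto)
  have fin: "finite (K \<union> K')" using assms by simp
  have le: "det (hessian a (K \<union> K') x) * ?f (score a (K \<union> K') x)
      \<le> ?c * (det (hessian a' (K \<union> K') x) * ?f (score a' (K \<union> K') x))" for x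
  proof -
    \<comment> \<open>The determinants are compared through the Hessian of the shared indices.
      Removing the terms of \<open>a\<close> costs a factor, while inserting those of
      \<open>a'\<close> can only increase the determinant, so the determinant cost is paid
      once.\<close>
    have "hessian a' K x = hessian a K x"
      using assms(4) by (simp add: hessian_def)
    then have "det (hessian a (K \<union> K') x) \<le> (1 + \<kappa>\<^sub>2 * q / \<gamma>) ^ card K' * det (hessian a' K x)"
      by (simp only:) (intro det_hessian_Un(2) assms(1-3) det_hessian_pos l2)
    also have "\<dots> \<le> (1 + \<kappa>\<^sub>2 * q / \<gamma>) ^ card K' * det (hessian a' (K \<union> K') x)"
    proof (rule mult_left_mono)
      obtain q' where "\<And>k. k \<in> K' \<Longrightarrow> (norm (a' k))\<^sup>2 \<le> q'"
        using finite_imageI[OF \<open>finite K'\<close>, of "\<lambda>k. (norm (a' k))\<^sup>2"] by (meson Max_ge imageI)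
      from det_hessian_Un(1)[OF assms(1-3) det_hessian_pos[OF assms(1)] this]
      show "det (hessian a' K x) \<le> det (hessian a' (K \<union> K') x)" .
      show "0 \<le> (1 + \<kappa>\<^sub>2 * q / \<gamma>) ^ card K'"
        using order_trans[OF convex bound2] gamma_pos \<open>0 \<le> q\<close> by simp
    qed
    also have "\<dots> \<le> exp (real (card K') * (\<kappa>\<^sub>2 * q / \<gamma>)) * det (hessian a' (K \<union> K') x)"
    proof (rule mult_right_mono)
      have "(1 + \<kappa>\<^sub>2 * q / \<gamma>) ^ card K' \<le> exp (\<kappa>\<^sub>2 * q / \<gamma>) ^ card K'"
        using order_trans[OF convex bound2] gamma_pos \<open>0 \<le> q\<close>
        by (intro power_mono exp_ge_add_one_self) simp
      then show "(1 + \<kappa>\<^sub>2 * q / \<gamma>) ^ card K' \<le> exp (real (card K') * (\<kappa>\<^sub>2 * q / \<gamma>))"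
        by (simp only: exp_of_nat_mult)
      show "0 \<le> det (hessian a' (K \<union> K') x)"
        by (intro less_imp_le det_hessian_pos fin)
    qed
    finally have det: "det (hessian a (K \<union> K') x)
        \<le> exp (real (card K') * (\<kappa>\<^sub>2 * q / \<gamma>)) * det (hessian a' (K \<union> K') x)" .
    have "(\<Sum>i\<in>UNIV. \<bar>score a (K \<union> K') x $ i - score a' (K \<union> K') x $ i\<bar>) / b
        \<le> real (card K') * (2 * \<kappa>\<^sub>1 * r / b)"
      using divide_right_mono[OF score_Un_diff[where x = x, OF assms(1-4) l1], where c = b] \<open>0 < b\<close>
      by (simp add: mult_ac)
    then have "exp ((\<Sum>i\<in>UNIV. \<bar>score a (K \<union> K') x $ i - score a' (K \<union> K') x $ i\<bar>) / b)
        \<le> exp (real (card K') * (2 * \<kappa>\<^sub>1 * r / b))"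
      by (simp only: exp_le_cancel_iff)
    from order_trans[OF laplace_density_vec_le[OF \<open>0 < b\<close>] mult_right_mono[OF this nonneg]]
    have lap: "?f (score a (K \<union> K') x)
        \<le> exp (real (card K') * (2 * \<kappa>\<^sub>1 * r / b)) * ?f (score a' (K \<union> K') x)" .
    have "det (hessian a (K \<union> K') x) * ?f (score a (K \<union> K') x)
        \<le> (exp (real (card K') * (\<kappa>\<^sub>2 * q / \<gamma>)) * det (hessian a' (K \<union> K') x)) *
          (exp (real (card K') * (2 * \<kappa>\<^sub>1 * r / b)) * ?f (score a' (K \<union> K') x))"
    proof (rule mult_mono[OF det lap])
      show "0 \<le> exp (real (card K') * (\<kappa>\<^sub>2 * q / \<gamma>)) * det (hessian a' (K \<union> K') x)"
        by (intro mult_nonneg_nonneg exp_ge_zero less_imp_le det_hessian_pos fin)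
    qed (rule nonneg)
    then show ?thesis
      by (simp add: distrib_left exp_add mult_ac)
  qed
  note meas = measure_estimate[OF int nonneg W fin B]
  show ?thesis
    unfolding meas(2) integral_mult_right[symmetric]
    using meas(1) le
    by (intro integral_le) (auto simp: absolutely_integrable_on_def intro: integrable_on_mult_right)
qed

end

section \<open>The pairwise comparison likelihood\<close>

text \<open>
  The change of variables formula of the library needs an index type of class \<open>wellorder\<close>, which a
  type of sort \<open>{finite, linorder}\<close> is not an instance of; a copy of the type can be made one.
\<close>

datatype 'n idx = Idx (item: 'n)

instance idx :: (finite) finite
proof
  have "(UNIV :: 'a idx set) = range Idx"
    by (metis idx.exhaust surjI surj_def)
  moreover have "finite (range (Idx :: 'a \<Rightarrow> 'a idx))"
    by (intro finite_imageI finite)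
  ultimately show "finite (UNIV :: 'a idx set)"
    by (simp only:)
qed

instantiation idx :: (linorder) linorder
begin

definition less_eq_idx :: "'a idx \<Rightarrow> 'a idx \<Rightarrow> bool" where
  "x \<le> y \<longleftrightarrow> item x \<le> item y"

definition less_idx :: "'a idx \<Rightarrow> 'a idx \<Rightarrow> bool" where
  "x < y \<longleftrightarrow> item x < item y"

instance
  by standard (auto simp: less_eq_idx_def less_idx_def intro: idx.expand)

end

instance idx :: ("{finite, linorder}") wellorder
proof
  fix P :: "'a idx \<Rightarrow> bool" and x
  assume step: "\<And>x. (\<And>y. y < x \<Longrightarrow> P y) \<Longrightarrow> P x"
  show "P x"
  \<comment> \<open>The number of predecessors serves as a rank that strictly decreases along the
    order.\<close>
  proof (induction "card {y. y < x}" arbitrary: x rule: less_induct)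
    case less
    have "P y" if "y < x" for y
      using that by (intro less psubset_card_mono) auto
    then show ?case by (rule step)
  qed
qed

lemma bij_item: "bij item"
  by (rule bijI') (auto intro: idx.expand exI[of _ "Idx _"])

section \<open>Transport to the copied index type\<close>

definition to_idx :: "real ^ 'n \<Rightarrow> real ^ 'n idx" where
  "to_idx x = (\<chi> j. x $ item j)"

definition of_idx :: "real ^ 'n idx \<Rightarrow> real ^ 'n" where
  "of_idx x = (\<chi> i. x $ Idx i)"

lemma of_idx_to_idx [simp]: "of_idx (to_idx x) = x"
  and to_idx_of_idx [simp]: "to_idx (of_idx y) = y"
  by (simp_all add: of_idx_def to_idx_def vec_eq_iff)

lemma sum_item: "(\<Sum>j\<in>UNIV. h (item j)) = sum h (UNIV :: 'n::finite set)"
  by (rule sum.reindex_bij_betw) (rule bij_item)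

lemma inner_to_idx [simp]: "to_idx x \<bullet> to_idx y = x \<bullet> y"
  using sum_item[of "\<lambda>i. x $ i * y $ i"] by (simp add: to_idx_def inner_vec_def)

lemma norm_to_idx [simp]: "norm (to_idx x) = norm x"
  by (simp add: norm_eq_sqrt_inner)

lemma measurable_of_idx [measurable]: "of_idx \<in> borel_measurable borel"
proof (subst borel_measurable_euclidean_space, clarsimp simp: Basis_vec_def inner_axis)
  fix i :: "'n::finite"
  show "(\<lambda>x :: real ^ 'n idx. of_idx x $ i) \<in> borel_measurable borel"
    by (simp add: of_idx_def)
qed

text \<open>The unit vector of the preferred item minus that of the other, so that
  \<open>F (direction c \<bullet> \<theta>)\<close> is the model probability of the observed
  outcome. \<open>Min\<close> and \<open>Max\<close> recover the ordered pair from the set.\<close>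

definition direction :: "'n comparison \<Rightarrow> real ^ 'n::{finite,linorder}" where
  "direction c = snd c *\<^sub>R (axis (Min (fst c)) 1 - axis (Max (fst c)) 1)"

lemma direction_pair:
  "i < j \<Longrightarrow> direction ({i, j}, y) = y *\<^sub>R (axis i 1 - axis j 1)"
  by (simp add: direction_def)

lemma norm_direction:
  fixes c :: "'n::{finite,linorder} comparison"
  assumes "c \<in> comparisons"
  shows "(norm (direction c))\<^sup>2 = 2"
proof -
  obtain i j y where c: "c = ({i, j}, y)" "i < j" "y \<in> {1, -1}"
    using assms by (auto simp: comparisons_def)
  have "(norm (direction c))\<^sup>2 = (norm (axis i 1 - axis j 1 :: real ^ 'n::{finite,linorder}))\<^sup>2"
    using c by (auto simp: direction_pair norm_minus_commute)
  also have "\<dots> = 2"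
    using c(2) unfolding power2_norm_eq_inner
    by (simp add: inner_diff inner_axis_axis)
  finally show ?thesis .
qed

lemma l1_direction:
  fixes c :: "'n::{finite,linorder} comparison"
  assumes "c \<in> comparisons"
  shows "(\<Sum>i\<in>UNIV. \<bar>direction c $ i\<bar>) = 2"
proof -
  obtain i j y where c: "c = ({i, j}, y)" "i < j" "y \<in> {1, -1}"
    using assms by (auto simp: comparisons_def)
  have "\<bar>direction c $ k\<bar> = (if k = i then 1 else 0) + (if k = j then 1 else 0)" for k
    using c by (auto simp: direction_pair axis_def)
  then show ?thesis by (simp add: sum.distrib)
qed

text \<open>For each pair, the count times the mean is the number of outcomes 1, and likewise for
  the complement. Since \<open>1 - F x = F (- x)\<close>, an outcome -1 is the same loss in the
  reversed direction.\<close>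

lemma neg_log_lik_eq_sum:
  fixes D :: "'n::{finite,linorder} dataset"
  assumes D: "D \<in> datasets m L" and sym: "\<And>x. F x = 1 - F (- x)"
  shows "neg_log_lik F m L D \<theta> =
    (\<Sum>(s, l)\<in>{1..m} \<times> {1..L}. - ln (F (direction (D s l) \<bullet> \<theta>)))"
proof -
  let ?K = "{1..m} \<times> {1..L}" and ?T = "{(i :: 'n, j). i < j}"
  let ?p = "\<lambda>(s, l). (Min (fst (D s l)), Max (fst (D s l)))"
  let ?h = "\<lambda>(s, l). - ln (F (direction (D s l) \<bullet> \<theta>))"
  have cmp: "D s l \<in> comparisons" if "(s, l) \<in> ?K" for s l
    using D that by (auto simp: datasets_def PiE_iff)
  \<comment> \<open>The comparisons of a pair are a fibre of the map \<open>?p\<close>, which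
    prepares the regrouping of the double sum.\<close>
  have occ: "occurrences m L D i j = {k \<in> ?K. ?p k = (i, j)}" if "i < j" for i j
  proof -
    have iff: "fst (D s l) = {i, j} \<longleftrightarrow> Min (fst (D s l)) = i \<and> Max (fst (D s l)) = j"
      if "(s, l) \<in> ?K" for s l
    proof -
      have "D s l \<in> comparisons" using that by (rule cmp)
      then obtain i' j' y where "D s l = ({i', j'}, y)" "i' < j'"
        by (auto simp: comparisons_def)
      then show ?thesis using \<open>i < j\<close> by (auto simp: doubleton_eq_iff)
    qed
    show ?thesis
    proof (rule set_eqI)
      fix k :: "nat \<times> nat"
      obtain s l where k: "k = (s, l)" by fastforce
      show "k \<in> occurrences m L D i j \<longleftrightarrow> k \<in> {k \<in> ?K. ?p k = (i, j)}"
      proof (cases "(s, l) \<in> ?K")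
        case True
        then show ?thesis using iff[OF True] by (simp add: k occurrences_def)
      qed (auto simp: k occurrences_def)
    qed
  qed
  have term_eq: "real (num_comparisons m L D i j) *
      (- mean_outcome m L D i j * ln (F (\<theta> $ i - \<theta> $ j))
       - (1 - mean_outcome m L D i j) * ln (1 - F (\<theta> $ i - \<theta> $ j)))
      = (\<Sum>k\<in>occurrences m L D i j. ?h k)" if "i < j" for i j
  proof -
    let ?O = "occurrences m L D i j" and ?x = "\<theta> $ i - \<theta> $ j"
    let ?y = "\<lambda>(s, l). snd (D s l)"
    have fin: "finite ?O" unfolding occ[OF that] by simp
    \<comment> \<open>For a pair that is never compared both sides are 0; otherwise the count
      cancels the division in the mean.\<close>
    have mean: "real (card ?O) * mean_outcome m L D i j = (\<Sum>k\<in>?O. (1 + ?y k) / 2)"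
      using fin by (cases "?O = {}") (simp_all add: mean_outcome_def num_comparisons_def case_prod_beta)
    then have mean': "real (card ?O) * (1 - mean_outcome m L D i j) = (\<Sum>k\<in>?O. (1 - ?y k) / 2)"
      by (simp add: right_diff_distrib add_divide_distrib diff_divide_distrib sum.distrib sum_subtractf)
    \<comment> \<open>The outcome being 1 or -1, one of the two weights is 1 and the other is
      0.\<close>
    have "?h k = - ((1 + ?y k) / 2) * ln (F ?x) - ((1 - ?y k) / 2) * ln (1 - F ?x)" if "k \<in> ?O" for k
    proof -
      obtain s l where k: "k = (s, l)" by fastforce
      have "fst (D s l) = {i, j}" "(s, l) \<in> ?K"
        using that unfolding k by (auto simp: occurrences_def)
      moreover from cmp[OF this(2)] have "snd (D s l) \<in> {1, -1}"
        by (auto simp: comparisons_def)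
      moreover have "1 - F ?x = F (- ?x)"
        using sym[of ?x] by simp
      ultimately show ?thesis
        using \<open>i < j\<close> unfolding k
        by (auto simp: direction_def inner_diff_left inner_axis' )
    qed
    then have "(\<Sum>k\<in>?O. ?h k) =
        (\<Sum>k\<in>?O. - ((1 + ?y k) / 2) * ln (F ?x) - ((1 - ?y k) / 2) * ln (1 - F ?x))"
      by (rule sum.cong[OF refl])
    also have "\<dots> = - (\<Sum>k\<in>?O. (1 + ?y k) / 2) * ln (F ?x) - (\<Sum>k\<in>?O. (1 - ?y k) / 2) * ln (1 - F ?x)"
      by (simp only: sum_subtractf sum_distrib_right sum_negf mult_minus_left)
    also have "\<dots> = real (card ?O) * (- mean_outcome m L D i j * ln (F ?x)
        - (1 - mean_outcome m L D i j) * ln (1 - F ?x))"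
      unfolding mean[symmetric] mean'[symmetric] by (simp add: algebra_simps)
    finally show ?thesis by (simp add: num_comparisons_def)
  qed
  have "neg_log_lik F m L D \<theta> = (\<Sum>q\<in>?T. \<Sum>k\<in>{k \<in> ?K. ?p k = q}. ?h k)"
    unfolding neg_log_lik_def
  proof (rule sum.cong[OF refl], clarsimp simp only: mem_Collect_eq prod.case)
    fix i j :: 'n assume "i < j"
    from term_eq[OF this] occ[OF this]
    show "real (num_comparisons m L D i j) *
        (- mean_outcome m L D i j * ln (F (\<theta> $ i - \<theta> $ j))
         - (1 - mean_outcome m L D i j) * ln (1 - F (\<theta> $ i - \<theta> $ j)))
        = (\<Sum>k\<in>{k \<in> ?K. ?p k = (i, j)}. ?h k)"
      by (simp only:)
  qed
  \<comment> \<open>Every comparison involves two distinct items, so the fibres over the pairs with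
    \<open>i < j\<close> exhaust \<open>?K\<close>.\<close>
  also have "\<dots> = (\<Sum>k\<in>?K. ?h k)"
  proof (rule sum.group)
    have "Min (fst (D s l)) < Max (fst (D s l))" if "(s, l) \<in> ?K" for s l
      using cmp[OF that] by (auto simp: comparisons_def)
    then show "?p ` ?K \<subseteq> ?T" by auto
  qed auto
  finally show ?thesis .
qed

text \<open>(A0) keeps \<open>F\<close> strictly between 0 and 1, (A1) bounds the first derivative
  of the loss, and (A2) bounds the second.\<close>

lemma convex_loss_neg_ln:
  assumes F: "twice_differentiable F" "cond_A0 F" "cond_A1 F \<kappa>\<^sub>1" "cond_A2 F \<kappa>\<^sub>2" and "0 < \<gamma>"
  shows "convex_loss (\<lambda>x. - ln (F x)) (\<lambda>x. - deriv F x / F x) (deriv (deriv (\<lambda>x. - ln (F x)))) \<kappa>\<^sub>1 \<kappa>\<^sub>2 \<gamma>"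
proof
  have "range F \<subseteq> {0..1}" and "strict_mono F"
    using F(2) by (simp_all only: cond_A0_def)
  then have range: "F x \<in> {0..1}" for x
    by blast
  \<comment> \<open>Strict monotonicity against the neighbours \<open>x - 1\<close> and
    \<open>x + 1\<close>, where \<open>F\<close> lies in the closed unit interval.\<close>
  have F01: "0 < F x" "F x < 1" for x
    using range[of "x - 1"] range[of "x + 1"] strict_monoD[OF \<open>strict_mono F\<close>, of "x - 1" x]
      strict_monoD[OF \<open>strict_mono F\<close>, of x "x + 1"] by auto
  have F': "(F has_real_derivative deriv F x) (at x)"
    and F'': "(deriv F has_real_derivative deriv (deriv F) x) (at x)" for x
    using F(1) by (simp_all add: twice_differentiable_def DERIV_deriv_iff_real_differentiable)
  show deriv1: "((\<lambda>x. - ln (F x)) has_real_derivative - deriv F x / F x) (at x)" for x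
    using F01[of x] by (auto intro!: derivative_eq_intros F' simp: field_simps)
  then have "deriv (\<lambda>x. - ln (F x)) = (\<lambda>x. - deriv F x / F x)"
    by (intro ext DERIV_imp_deriv)
  moreover have "(\<lambda>x. - deriv F x / F x) differentiable at x" for x
    using DERIV_divide[OF DERIV_minus[OF F''] F', of x] F01[of x]
    unfolding real_differentiable_def by (intro exI) simp
  ultimately show "((\<lambda>x. - deriv F x / F x) has_real_derivative deriv (deriv (\<lambda>x. - ln (F x))) x) (at x)" for x
    by (simp add: DERIV_deriv_iff_real_differentiable)
  show "0 \<le> - ln (F x)" for x
    using F01[of x] by simp
  show "\<bar>- deriv F x / F x\<bar> \<le> \<kappa>\<^sub>1" for x
  proof -
    have "0 \<le> deriv F x"
      using strict_mono_mono[OF \<open>strict_mono F\<close>] by (rule mono_on_imp_deriv_nonneg[OF _ F']) simp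
    have "ereal (deriv F x / (F x * (1 - F x))) < ereal \<kappa>\<^sub>1"
      using F(3) unfolding cond_A1_def by (meson SUP_upper UNIV_I le_less_trans)
    \<comment> \<open>The extra factor \<open>1 - F x\<close> in the denominator lies between 0 and
      1.\<close>
    moreover have "deriv F x / F x \<le> deriv F x / (F x * (1 - F x))"
      using F01[of x] \<open>0 \<le> deriv F x\<close> by (intro divide_left_mono) (auto simp: mult_le_cancel_left1)
    ultimately show ?thesis
      using F01[of x] \<open>0 \<le> deriv F x\<close> by simp
  qed
  show "0 \<le> deriv (deriv (\<lambda>x. - ln (F x))) x" "deriv (deriv (\<lambda>x. - ln (F x))) x \<le> \<kappa>\<^sub>2" for x
    using F(4) by (auto simp: cond_A2_def Let_def less_imp_le)
qed fact

section \<open>Privacy of the perturbed estimator\<close>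

theorem proposition3p1:
  fixes F :: "real \<Rightarrow> real"
    and \<kappa>\<^sub>1 \<kappa>\<^sub>2 \<epsilon> lam \<gamma> :: real
    and m L :: nat
    and P :: "'a measure"
    and w :: "'a \<Rightarrow> real ^ ('n :: {finite, linorder})"
  assumes "twice_differentiable F"
    and "cond_A0 F" and "cond_A1 F \<kappa>\<^sub>1" and "cond_A2 F \<kappa>\<^sub>2"
    and "L \<ge> 1" and "\<epsilon> > 0"
    and "lam \<ge> 8 * real L * \<kappa>\<^sub>1 / \<epsilon>"
    and "\<gamma> \<ge> 8 * real L * \<kappa>\<^sub>2 / \<epsilon>"
    and "prob_space P" and "iid_laplace P lam w"
  shows "individual_dp m L borel
           (\<lambda>D. distr P borel (\<lambda>\<omega>. perturbed_mle F m L \<gamma> D (w \<omega>))) \<epsilon> 0"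
proof -
  have pos: "0 < \<kappa>\<^sub>1" "0 < \<kappa>\<^sub>2"
    using assms(3,4) by (auto simp: cond_A1_def cond_A2_def Let_def)
  then have "0 < 8 * real L * \<kappa>\<^sub>1 / \<epsilon>" "0 < 8 * real L * \<kappa>\<^sub>2 / \<epsilon>"
    using \<open>L \<ge> 1\<close> \<open>\<epsilon> > 0\<close> by auto
  then have "0 < lam" "0 < \<gamma>"
    using assms(7,8) by linarith+
  interpret convex_loss "\<lambda>x. - ln (F x)" "\<lambda>x. - deriv F x / F x"
      "deriv (deriv (\<lambda>x. - ln (F x)))" \<kappa>\<^sub>1 \<kappa>\<^sub>2 \<gamma>
    using assms(1-4) \<open>0 < \<gamma>\<close> by (rule convex_loss_neg_ln)
  have sym: "F x = 1 - F (- x)" for x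
    using assms(2) unfolding cond_A0_def by blast
  let ?K = "{1..m} \<times> {1..L}"
  let ?W = "\<lambda>\<omega>. to_idx (w \<omega>)"
  define a :: "'n dataset \<Rightarrow> nat \<times> nat \<Rightarrow> real ^ 'n idx"
    where "a D = (\<lambda>(s, l). to_idx (direction (D s l)))" for D
  note joint = iid_laplace_joint_density[OF assms(9,10) \<open>0 < lam\<close> bij_item, folded to_idx_def]
  \<comment> \<open>The relabelling carries one objective to the other, so minimisers correspond;
    uniqueness of the minimiser then identifies the two choices made by
    \<open>arg_min\<close>.\<close>
  have mle: "perturbed_mle F m L \<gamma> D v = of_idx (estimate (a D) ?K (to_idx v))"
    if D: "D \<in> datasets m L" for D v
  proof -
    have obj: "perturbed_objective F m L \<gamma> D v \<theta> = objective (a D) ?K (to_idx v) (to_idx \<theta>)" for \<theta>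
      unfolding perturbed_objective_def objective_def neg_log_lik_eq_sum[where F = F, OF D sym]
      by (simp add: a_def case_prod_beta)
    let ?min = "is_arg_min (perturbed_objective F m L \<gamma> D v) (\<lambda>_. True)"
    have "?min (of_idx (estimate (a D) ?K (to_idx v)))"
      by (simp add: is_arg_min_linorder obj estimate_minimizes)
    then have "?min (perturbed_mle F m L \<gamma> D v)"
      unfolding perturbed_mle_def arg_min_def by (rule someI)
    then have "objective (a D) ?K (to_idx v) (to_idx (perturbed_mle F m L \<gamma> D v))
        \<le> objective (a D) ?K (to_idx v) y" for y
      by (metis is_arg_min_linorder obj to_idx_of_idx)
    from estimate_eqI[OF this] show ?thesis by simp
  qed
  have W [measurable]: "?W \<in> borel_measurable P" by (rule joint(1))
  \<comment> \<open>Relabelling back is a measurable post-processing, so it suffices to bound the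
    law on the copied index type.\<close>
  have distr: "distr P borel (\<lambda>\<omega>. perturbed_mle F m L \<gamma> D (w \<omega>))
      = distr (distr P borel (\<lambda>\<omega>. estimate (a D) ?K (?W \<omega>))) borel of_idx"
    if "D \<in> datasets m L" for D
    by (simp add: mle[OF that] distr_distr o_def)
  show ?thesis
    unfolding individual_dp_def
  proof (intro conjI ballI allI impI)
    fix D :: "'n dataset" assume D: "D \<in> datasets m L"
    have "prob_space (distr P borel (\<lambda>\<omega>. of_idx (estimate (a D) ?K (?W \<omega>))))"
      by (intro prob_space.prob_space_distr assms(9)) measurable
    then show "distr P borel (\<lambda>\<omega>. perturbed_mle F m L \<gamma> D (w \<omega>)) \<in> space (prob_algebra borel)"
      by (simp add: space_prob_algebra mle[OF D])
  next
    fix D D' :: "'n dataset" and A :: "(real ^ 'n::{finite,linorder}) set"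
    assume adj: "adjacent m L D D'" and A: "A \<in> sets borel"
    then obtain s c where D: "D \<in> datasets m L" and s: "s \<in> {1..m}"
      and c: "c \<in> {1..L} \<rightarrow>\<^sub>E comparisons" and D'_def: "D' = D(s := c)"
      by (auto simp: adjacent_def)
    have D': "D' \<in> datasets m L"
      using D s c unfolding D'_def datasets_def by (auto simp: PiE_iff extensional_def)
    have cmp: "E t l \<in> comparisons" if "E \<in> datasets m L" "(t, l) \<in> ?K" for E :: "'n dataset" and t l
      using that by (auto simp: datasets_def PiE_iff)
    \<comment> \<open>The replaced user \<open>s\<close> owns \<open>L\<close> indices; on all the
      others the two data sets agree.\<close>
    let ?others = "({1..m} - {s}) \<times> {1..L}" and ?own = "{s} \<times> {1..L}"
    have K: "?others \<union> ?own = ?K" "?others \<inter> ?own = {}" and sub: "?own \<subseteq> ?K"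
      using s by blast+
    have card: "real (card ?own) = real L" by (simp add: card_cartesian_product)
    have l1: "(\<Sum>i\<in>UNIV. \<bar>a E k $ i\<bar>) \<le> 2" and l2: "(norm (a E k))\<^sup>2 \<le> 2"
      if E: "E \<in> datasets m L" and own: "k \<in> ?own" for E k
    proof -
      obtain t l where k: "k = (t, l)" and "(t, l) \<in> ?K" using own sub by auto
      then have "E t l \<in> comparisons" using cmp[OF E] by simp
      then show "(\<Sum>i\<in>UNIV. \<bar>a E k $ i\<bar>) \<le> 2" "(norm (a E k))\<^sup>2 \<le> 2"
        using sum_item[of "\<lambda>i. \<bar>direction (E t l) $ i\<bar>"] l1_direction[of "E t l"]
        by (simp_all add: k a_def norm_direction) (simp add: to_idx_def)
    qed
    have same: "a D k = a D' k" if k: "k \<in> ?others" for k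
    proof -
      obtain t l where "k = (t, l)" "t \<noteq> s" using k by blast
      then show ?thesis by (simp add: a_def D'_def)
    qed
    have B: "of_idx -` A \<in> sets borel"
      using measurable_sets[OF measurable_of_idx A] by simp
    have "measure (distr P borel (\<lambda>\<omega>. perturbed_mle F m L \<gamma> D (w \<omega>))) A
        = measure (distr P borel (\<lambda>\<omega>. estimate (a D) ?K (?W \<omega>))) (of_idx -` A)"
      using A by (simp add: distr[OF D] measure_distr)
    \<comment> \<open>Here \<open>r\<close> and \<open>q\<close> are both 2, the 1-norm and the
      squared Euclidean norm of a signed difference of two unit vectors.\<close>
    also have "\<dots> \<le> exp (real L * (2 * \<kappa>\<^sub>1 * 2 / lam + \<kappa>\<^sub>2 * 2 / \<gamma>)) *
        measure (distr P borel (\<lambda>\<omega>. estimate (a D') ?K (?W \<omega>))) (of_idx -` A)"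
      using estimate_distr_ratio[OF _ _ K(2) same l1[OF D] l1[OF D'] l2[OF D] _ \<open>0 < lam\<close> assms(9) joint B]
      unfolding K(1) card by simp
    also have "measure (distr P borel (\<lambda>\<omega>. estimate (a D') ?K (?W \<omega>))) (of_idx -` A)
        = measure (distr P borel (\<lambda>\<omega>. perturbed_mle F m L \<gamma> D' (w \<omega>))) A"
      using A by (simp add: distr[OF D'] measure_distr)
    also have "exp (real L * (2 * \<kappa>\<^sub>1 * 2 / lam + \<kappa>\<^sub>2 * 2 / \<gamma>)) \<le> exp \<epsilon>"
    proof -
      \<comment> \<open>The noise term uses half of the first bound and the determinant term a
        quarter of the second, so the exponent is at most three quarters of
        \<open>\<epsilon>\<close>.\<close>
      have "8 * real L * \<kappa>\<^sub>1 / lam \<le> \<epsilon>" "8 * real L * \<kappa>\<^sub>2 / \<gamma> \<le> \<epsilon>"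
        using assms(7,8) \<open>0 < \<epsilon>\<close> \<open>0 < lam\<close> \<open>0 < \<gamma>\<close> by (simp_all add: field_simps)
      moreover have "real L * (2 * \<kappa>\<^sub>1 * 2 / lam + \<kappa>\<^sub>2 * 2 / \<gamma>)
          = (8 * real L * \<kappa>\<^sub>1 / lam) / 2 + (8 * real L * \<kappa>\<^sub>2 / \<gamma>) / 4"
        by (simp add: algebra_simps)
      ultimately have "real L * (2 * \<kappa>\<^sub>1 * 2 / lam + \<kappa>\<^sub>2 * 2 / \<gamma>) \<le> \<epsilon> / 2 + \<epsilon> / 4"
        by (simp only:) (intro add_mono divide_right_mono; simp)
      then show ?thesis using \<open>0 < \<epsilon>\<close> by (simp only: exp_le_cancel_iff)
    qed
    finally show "measure (distr P borel (\<lambda>\<omega>. perturbed_mle F m L \<gamma> D (w \<omega>))) A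
        \<le> exp \<epsilon> * measure (distr P borel (\<lambda>\<omega>. perturbed_mle F m L \<gamma> D' (w \<omega>))) A + 0"
      by (simp add: mult_right_mono)
  qed
qed

end
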